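(* There are oblivious message adversaries under which consensus is solvable but for which the decision procedure takes exponential time to terminate. Precisely: there exist constants $a>1$ and $n_0$ such that for every $n\ge n_0$ there is a set $\mathbf{D}$ of rooted communication graphs on $n$ processes such that consensus is solvable under $\mathbf{D}$ and $\mathrm{TD}(\mathbf{D})\ge a^n$.
   Context: **Model.** $\Pi=\{p_1,\dots,p_n\}$ is a set of $n$ processes. A communication graph is a directed graph on $\Pi$ containing all self-loops; $\mathrm{In}_G(p)=\{q:(q,p)\in E(G)\}$. An oblivious message adversary is given by a nonempty set $\mathbf{D}$ of communication graphs; its admissible infinite communication patterns are all sequences $\sigma=(\sigma(1),\sigma(2),\dots)\in\mathbf{D}^\omega$ with every $\sigma(r)\in\mathbf{D}$. Given inputs $(x_p)_{p\in\Pi}$, views are defined by $\mathrm{view}_\sigma(p,0)=\{(p,0,x_p)\}$ and, for $r\ge1$, $\mathrm{view}_\sigma(p,r)=(p,r,\{\mathrm{view}_\sigma(q,r-1):(q,p)\in\sigma(r)\})$. **Consensus.** Each process $p$ has an input $x_p$ from a finite domain $V$. A (deterministic, full-information) consensus algorithm is a family of decision functions $\Delta_p$ mapping each possible view of $p$ to $V\cup\{\bot\}$ such that if $\Delta_p(\mathrm{view}_\sigma(p,r))\ne\bot$ then $\Delta_p(\mathrm{view}_\sigma(p,r'))=\Delta_p(\mathrm{view}_\sigma(p,r))$ for all $r'\ge r$. A run is determined by an input assignment and some $\sigma\in\mathbf{D}^\omega$; $p$ decides $v\ne\bot$ if $\Delta_p(\mathrm{view}_\sigma(p,r))=v$ for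 some $r$. The algorithm is correct under $\mathbf{D}$ if in every run every process eventually decides (termination), no two processes decide differently (agreement), and every decided value is the input of some process (validity). Consensus is solvable under $\mathbf{D}$ if a correct algorithm exists. **Roots.** A root component of a graph is a strongly connected component with no incoming edge from outside. A graph $G$ is rooted if it has exactly one root component, whose node set is $\mathrm{Root}(G)$. A set $\mathbf{S}$ of rooted communication graphs is root-compatible if $\bigcap_{G\in\mathbf{S}}\mathrm{Root}(G)\ne\emptyset$. **Decision procedure.** $I(\mathbf{D})$ is the undirected graph with node set $\mathbf{D}$ in which $G,H$ are joined by an edge $e$ iff its label $\ell(e)=\{p\in\Pi:\mathrm{In}_G(p)=\mathrm{In}_H(p)\}$ is nonempty. Put $\mathcal{N}_1=I(\mathbf{D})$. For $i\ge2$, $\mathcal{N}_i$ has node set $\mathbf{D}$, and its edges are those edges $e$ of $\mathcal{N}_{i-1}$ for which the connected component of $\mathcal{N}_{i-1}$ containing $e$ contains a node $G$ with $\mathrm{Root}(G)\subseteq\ell(e)$. The decision procedure computes $\mathcal{N}_2,\mathcal{N}_3,\dots$ and stops at the first index $i\ge2$ such that $\mathcal{N}_i=\mathcal{N}_{i-1}$ or all connected components of $\mathcal{N}_i$ are root-compatible; this index is the number of iterations $\mathrm{TD}(\mathbf{D})$, which is the time complexity of the procedure. *)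

theory Defs
  imports Complex_Main "HOL-Library.FSet" "Graph_Theory.Graph_Theory"
begin

section \<open>Communication graphs and oblivious message adversaries\<close>

type_synonym 'p cgraph = "'p pair_pre_digraph"

definition communication_graph :: "'p set \<Rightarrow> 'p cgraph \<Rightarrow> bool" where
  "communication_graph P G \<longleftrightarrow>
     pair_wf_digraph G \<and> pverts G = P \<and> (\<forall>p\<in>P. (p, p) \<in> parcs G)"

definition In :: "'p cgraph \<Rightarrow> 'p \<Rightarrow> 'p set" where
  "In G p = {q. (q, p) \<in> parcs G}"

definition message_adversary :: "'p set \<Rightarrow> 'p cgraph set \<Rightarrow> bool" where
  "message_adversary P D \<longleftrightarrow> D \<noteq> {} \<and> (\<forall>G\<in>D. communication_graph P G)"

text \<open>Rounds are numbered from 1; the value \<open>\<sigma> 0\<close> is never used.\<close>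

definition admissible :: "'p cgraph set \<Rightarrow> (nat \<Rightarrow> 'p cgraph) \<Rightarrow> bool" where
  "admissible D \<sigma> \<longleftrightarrow> (\<forall>r\<ge>1. \<sigma> r \<in> D)"


section \<open>Views and consensus\<close>

datatype ('p, 'v) view =
    Initial_View 'p nat 'v
  | Round_View 'p nat "('p, 'v) view fset"

text \<open>
  The views received in a round form a set. A datatype cannot recurse through
  arbitrary sets, so \<^const>\<open>Abs_fset\<close> converts it to the finite set it is whenever
  there are finitely many processes.
\<close>

primrec view_of :: "(nat \<Rightarrow> 'p cgraph) \<Rightarrow> ('p \<Rightarrow> 'v) \<Rightarrow> nat \<Rightarrow> 'p \<Rightarrow> ('p, 'v) view" where
  "view_of \<sigma> x 0 = (\<lambda>p. Initial_View p 0 (x p))"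
| "view_of \<sigma> x (Suc r) =
     (\<lambda>p. Round_View p (Suc r) (Abs_fset {view_of \<sigma> x r q |q. q \<in> In (\<sigma> (Suc r)) p}))"

definition input_assignment :: "'p set \<Rightarrow> 'v set \<Rightarrow> ('p \<Rightarrow> 'v) \<Rightarrow> bool" where
  "input_assignment P V x \<longleftrightarrow> (\<forall>p\<in>P. x p \<in> V)"

text \<open>
  \<^const>\<open>None\<close> stands for \<open>\<bottom>\<close> (undecided). The views on which a decision function is
  constrained are those that occur in some run under \<open>D\<close>.
\<close>

definition consensus_algorithm ::
  "'p set \<Rightarrow> 'v set \<Rightarrow> 'p cgraph set \<Rightarrow> ('p \<Rightarrow> ('p, 'v) view \<Rightarrow> 'v option) \<Rightarrow> bool" where
  "consensus_algorithm P V D \<Delta> \<longleftrightarrow>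
     (\<forall>x \<sigma>. input_assignment P V x \<and> admissible D \<sigma> \<longrightarrow>
        (\<forall>p\<in>P. \<forall>r.
           \<Delta> p (view_of \<sigma> x r p) \<in> insert None (Some ` V) \<and>
           (\<Delta> p (view_of \<sigma> x r p) \<noteq> None \<longrightarrow>
              (\<forall>r'\<ge>r. \<Delta> p (view_of \<sigma> x r' p) = \<Delta> p (view_of \<sigma> x r p)))))"

definition decides ::
  "('p \<Rightarrow> ('p, 'v) view \<Rightarrow> 'v option) \<Rightarrow> (nat \<Rightarrow> 'p cgraph) \<Rightarrow> ('p \<Rightarrow> 'v) \<Rightarrow> 'p \<Rightarrow> 'v \<Rightarrow> bool" where
  "decides \<Delta> \<sigma> x p v \<longleftrightarrow> (\<exists>r. \<Delta> p (view_of \<sigma> x r p) = Some v)"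

definition satisfies_termination ::
  "'p set \<Rightarrow> ('p \<Rightarrow> ('p, 'v) view \<Rightarrow> 'v option) \<Rightarrow> (nat \<Rightarrow> 'p cgraph) \<Rightarrow> ('p \<Rightarrow> 'v) \<Rightarrow> bool" where
  "satisfies_termination P \<Delta> \<sigma> x \<longleftrightarrow> (\<forall>p\<in>P. \<exists>v. decides \<Delta> \<sigma> x p v)"

definition satisfies_agreement ::
  "'p set \<Rightarrow> ('p \<Rightarrow> ('p, 'v) view \<Rightarrow> 'v option) \<Rightarrow> (nat \<Rightarrow> 'p cgraph) \<Rightarrow> ('p \<Rightarrow> 'v) \<Rightarrow> bool" where
  "satisfies_agreement P \<Delta> \<sigma> x \<longleftrightarrow>
     (\<forall>p\<in>P. \<forall>q\<in>P. \<forall>v w. decides \<Delta> \<sigma> x p v \<and> decides \<Delta> \<sigma> x q w \<longrightarrow> v = w)"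

definition satisfies_validity ::
  "'p set \<Rightarrow> ('p \<Rightarrow> ('p, 'v) view \<Rightarrow> 'v option) \<Rightarrow> (nat \<Rightarrow> 'p cgraph) \<Rightarrow> ('p \<Rightarrow> 'v) \<Rightarrow> bool" where
  "satisfies_validity P \<Delta> \<sigma> x \<longleftrightarrow> (\<forall>p\<in>P. \<forall>v. decides \<Delta> \<sigma> x p v \<longrightarrow> (\<exists>q\<in>P. x q = v))"

definition correct_under ::
  "'p set \<Rightarrow> 'v set \<Rightarrow> 'p cgraph set \<Rightarrow> ('p \<Rightarrow> ('p, 'v) view \<Rightarrow> 'v option) \<Rightarrow> bool" where
  "correct_under P V D \<Delta> \<longleftrightarrow>
     (\<forall>x \<sigma>. input_assignment P V x \<and> admissible D \<sigma> \<longrightarrow>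
        satisfies_termination P \<Delta> \<sigma> x \<and> satisfies_agreement P \<Delta> \<sigma> x \<and> satisfies_validity P \<Delta> \<sigma> x)"

definition consensus_solvable :: "'p set \<Rightarrow> 'v set \<Rightarrow> 'p cgraph set \<Rightarrow> bool" where
  "consensus_solvable P V D \<longleftrightarrow>
     (\<exists>\<Delta>. consensus_algorithm P V D \<Delta> \<and> correct_under P V D \<Delta>)"


section \<open>Root components\<close>

definition root_component :: "'p cgraph \<Rightarrow> 'p set \<Rightarrow> bool" where
  "root_component G C \<longleftrightarrow>
     C \<in> pre_digraph.sccs_verts (with_proj G) \<and> (\<forall>(q, p)\<in>parcs G. p \<in> C \<longrightarrow> q \<in> C)"

definition rooted :: "'p cgraph \<Rightarrow> bool" where
  "rooted G \<longleftrightarrow> (\<exists>!C. root_component G C)"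

definition Root :: "'p cgraph \<Rightarrow> 'p set" where
  "Root G = (THE C. root_component G C)"

definition root_compatible :: "'p cgraph set \<Rightarrow> bool" where
  "root_compatible S \<longleftrightarrow> (\<forall>G\<in>S. rooted G) \<and> (\<Inter>G\<in>S. Root G) \<noteq> {}"


section \<open>The decision procedure\<close>

text \<open>
  Undirected graphs on a set of communication graphs are symmetric digraphs, so that
  their connected components are the strongly connected ones. Loops are left out; they
  carry the label \<open>P\<close>, would never be removed, and do not affect connectivity.
\<close>

definition label :: "'p set \<Rightarrow> 'p cgraph \<Rightarrow> 'p cgraph \<Rightarrow> 'p set" where
  "label P G H = {p \<in> P. In G p = In H p}"

definition indist_graph :: "'p set \<Rightarrow> 'p cgraph set \<Rightarrow> 'p cgraph pair_pre_digraph" where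
  "indist_graph P D =
     \<lparr> pverts = D, parcs = {(G, H). G \<in> D \<and> H \<in> D \<and> G \<noteq> H \<and> label P G H \<noteq> {}} \<rparr>"

definition refine :: "'p set \<Rightarrow> 'p cgraph pair_pre_digraph \<Rightarrow> 'p cgraph pair_pre_digraph" where
  "refine P N =
     \<lparr> pverts = pverts N,
       parcs = {(G, H) \<in> parcs N.
                  \<exists>K \<in> pre_digraph.scc_of (with_proj N) G. Root K \<subseteq> label P G H} \<rparr>"

text \<open>The sequence starts at index 1; index 0 is never used.\<close>

definition refinement :: "'p set \<Rightarrow> 'p cgraph set \<Rightarrow> nat \<Rightarrow> 'p cgraph pair_pre_digraph" where
  "refinement P D i = (refine P ^^ (i - 1)) (indist_graph P D)"

definition stops_at :: "'p set \<Rightarrow> 'p cgraph set \<Rightarrow> nat \<Rightarrow> bool" where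
  "stops_at P D i \<longleftrightarrow>
     i \<ge> 2 \<and>
     (refinement P D i = refinement P D (i - 1) \<or>
      (\<forall>C \<in> pre_digraph.sccs_verts (with_proj (refinement P D i)). root_compatible C))"

definition TD :: "'p set \<Rightarrow> 'p cgraph set \<Rightarrow> nat" where
  "TD P D = (LEAST i. stops_at P D i)"

lemma indist_graph_symmetric: "sym (parcs (indist_graph P D))"
  by (auto simp: sym_def indist_graph_def label_def)

lemma refine_symmetric:
  assumes "sym (parcs N)" and "parcs N \<subseteq> pverts N \<times> pverts N"
  shows "sym (parcs (refine P N))"
proof (rule symI)
  fix G H assume *: "(G, H) \<in> parcs (refine P N)"
  then have GH: "(G, H) \<in> parcs N" "(H, G) \<in> parcs N"
    using assms(1) by (auto simp: refine_def dest: symD)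
  interpret pair_wf_digraph N using assms(2) by unfold_locales auto
  have "H \<rightarrow>\<^sup>*\<^bsub>with_proj N\<^esub> G" "G \<rightarrow>\<^sup>*\<^bsub>with_proj N\<^esub> H" using GH by auto
  then have "scc_of G = scc_of H"
    unfolding scc_of_def by (auto intro: reachable_trans)
  moreover have "label P G H = label P H G" by (auto simp: label_def)
  ultimately show "(H, G) \<in> parcs (refine P N)"
    using * GH by (auto simp: refine_def)
qed

text \<open>For finitely many processes the procedure stops, so the minimum in \<^const>\<open>TD\<close> exists.\<close>

lemma finite_message_adversary:
  assumes "finite P" and "message_adversary P D"
  shows "finite D"
proof (rule finite_subset)
  show "D \<subseteq> (\<lambda>E. \<lparr>pverts = P, parcs = E\<rparr>) ` Pow (P \<times> P)"
  proof
    fix G assume "G \<in> D"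
    then have G: "pair_wf_digraph G" "pverts G = P"
      using assms(2) by (auto simp: message_adversary_def communication_graph_def)
    then have "parcs G \<subseteq> P \<times> P"
      by (auto dest: pair_wf_digraph.wellformed')
    moreover have "G = \<lparr>pverts = P, parcs = parcs G\<rparr>" using G(2) by simp
    ultimately show "G \<in> (\<lambda>E. \<lparr>pverts = P, parcs = E\<rparr>) ` Pow (P \<times> P)" by blast
  qed
  show "finite ((\<lambda>E. \<lparr>pverts = P, parcs = E\<rparr>) ` Pow (P \<times> P))" using assms(1) by simp
qed

lemma refine_stabilizes:
  "finite (parcs N) \<Longrightarrow> \<exists>k. (refine P ^^ Suc k) N = (refine P ^^ k) N"
proof (induction "card (parcs N)" arbitrary: N rule: less_induct)
  case less
  have sub: "parcs (refine P N) \<subseteq> parcs N" by (auto simp: refine_def)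
  show ?case
  proof (cases "refine P N = N")
    case True
    then show ?thesis by (intro exI[of _ 0]) simp
  next
    case False
    then have "parcs (refine P N) \<noteq> parcs N" by (auto simp: refine_def)
    with sub less.prems have "card (parcs (refine P N)) < card (parcs N)"
      by (intro psubset_card_mono) auto
    then obtain k where "(refine P ^^ Suc k) (refine P N) = (refine P ^^ k) (refine P N)"
      using less.hyps sub less.prems finite_subset by blast
    then show ?thesis by (intro exI[of _ "Suc k"]) (simp add: funpow_swap1)
  qed
qed

lemma procedure_stops:
  assumes "finite P" and "message_adversary P D"
  shows "stops_at P D (TD P D)"
proof -
  have "finite (D \<times> D)" using finite_message_adversary[OF assms] by simp
  then have "finite (parcs (indist_graph P D))"
    by (rule finite_subset[rotated]) (auto simp: indist_graph_def)
  then obtain k where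
    "(refine P ^^ Suc k) (indist_graph P D) = (refine P ^^ k) (indist_graph P D)"
    using refine_stabilizes by blast
  then have "stops_at P D (k + 2)"
    by (simp add: stops_at_def refinement_def)
  then show ?thesis unfolding TD_def by (rule LeastI)
qed

end

theory Submission
  imports Defs
begin

text \<open>
  Lower bound. Take graphs \<open>G 0, \<dots>, G m\<close> with roots \<open>R 0, \<dots>, R m\<close> such that consecutive graphs
  \<open>G i, G (i + 1)\<close> agree exactly on the in-neighbourhoods of \<open>R (i + 2)\<close> and all other pairs agree
  nowhere. Then \<open>I(D)\<close> is a path, and the edge between \<open>G i\<close> and \<open>G (i + 1)\<close> is supported by
  \<open>G (i + 2)\<close> only, so that every iteration removes just the last edge of the path. As \<open>R 0\<close> and
  \<open>R 1\<close> are disjoint, the procedure cannot stop before the path is used up. It is enough that no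
  root is contained in the union of two consecutive others plus one element, and such families
  of exponential size arise from binary codes.

  Solvability. A process that cannot distinguish two long runs has heard of some process in every
  round, hence the graphs of both runs are joined by an edge of \<open>I(D)\<close> in every round. If enough later
  rounds lie in the same component, then by pigeonhole some \<open>K\<close> of this component recurs so
  often that the process hears from all of \<open>Root(K)\<close>, so the edge survives one more refinement.
  Iterating, indistinguishable runs share many rounds in one root-compatible component, whose
  common root process reaches everybody and can serve as the leader.
\<close>

section \<open>Finite sets of rounds\<close>

lemma pigeonhole_fiber:
  fixes f :: "'a \<Rightarrow> 'b"
  assumes "finite A" "finite B" "B \<noteq> {}" "f ` A \<subseteq> B" "m * card B \<le> card A"
  shows "\<exists>b\<in>B. m \<le> card {a\<in>A. f a = b}"
proof (rule ccontr)
  assume "\<not> ?thesis"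
  then have less: "card {a\<in>A. f a = b} < m" if "b \<in> B" for b using that by auto
  have "A = (\<Union>b\<in>B. {a\<in>A. f a = b})" using assms(4) by auto
  then have "card A \<le> (\<Sum>b\<in>B. card {a\<in>A. f a = b})"
    using card_UN_le[OF assms(2), of "\<lambda>b. {a\<in>A. f a = b}"] by simp
  also have "\<dots> < (\<Sum>b\<in>B. m)" using less assms by (intro sum_strict_mono) auto
  finally show False using assms(5) by (simp add: mult.commute)
qed

text \<open>Serves to split a set of rounds into early ones, whose edges are to be kept, and late
  ones, in which information spreads.\<close>

lemma ex_initial_segment_card:
  fixes T :: "nat set"
  assumes "finite T" "m \<le> card T"
  shows "\<exists>s. card (T \<inter> {..<s}) = m"
  using assms
proof (induction m)
  case 0
  have "card (T \<inter> {..<0}) = 0" by simp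
  then show ?case by blast
next
  case (Suc m)
  then obtain s where s: "card (T \<inter> {..<s}) = m" by auto
  have "T - {..<s} \<noteq> {}" using s Suc.prems by (metis Diff_eq_empty_iff Int_absorb2 Suc_n_not_le_n)
  define u where "u = (LEAST u. u \<in> T - {..<s})"
  have u: "u \<in> T - {..<s}" unfolding u_def using \<open>T - {..<s} \<noteq> {}\<close> by (metis LeastI ex_in_conv)
  have min: "u \<le> w" if "w \<in> T - {..<s}" for w unfolding u_def using that by (rule Least_le)
  have "T \<inter> {..<Suc u} = insert u (T \<inter> {..<s})"
    using u min by (auto simp: less_Suc_eq) (meson DiffI lessThan_iff not_le)
  then have "card (T \<inter> {..<Suc u}) = Suc m" using s u \<open>finite T\<close> by simp
  then show ?case by blast
qed

section \<open>Roots and reachability\<close>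

lemma reachable_with_proj_iff:
  assumes "pair_wf_digraph G"
  shows "u \<rightarrow>\<^sup>*\<^bsub>with_proj G\<^esub> v \<longleftrightarrow> u \<in> pverts G \<and> (u, v) \<in> (parcs G)\<^sup>*"
proof
  assume "u \<rightarrow>\<^sup>*\<^bsub>with_proj G\<^esub> v"
  then have "(u, v) \<in> rtrancl_on (pverts G) (parcs G)"
    by (simp add: reachable_def)
  then show "u \<in> pverts G \<and> (u, v) \<in> (parcs G)\<^sup>*"
    by induction (auto intro: rtrancl_into_rtrancl)
next
  interpret pair_wf_digraph G by fact
  assume *: "u \<in> pverts G \<and> (u, v) \<in> (parcs G)\<^sup>*"
  then have "(u, v) \<in> (parcs G)\<^sup>*" "u \<in> pverts G" by auto
  then have "(u, v) \<in> rtrancl_on (pverts G) (parcs G)"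
    by (induction rule: rtrancl_induct)
       (auto intro: rtrancl_on_into_rtrancl_on dest: wellformed')
  then show "u \<rightarrow>\<^sup>*\<^bsub>with_proj G\<^esub> v" by (simp add: reachable_def)
qed

text \<open>Among the ancestors of \<open>v\<close>, one with the fewest ancestors is taken. Each of
  its own ancestors has the same ancestor set, so this set is strongly connected, and it is closed
  under in-neighbours.\<close>

lemma ex_root_component_reaching:
  assumes wf: "pair_wf_digraph G" and fin: "finite (pverts G)" and v: "v \<in> pverts G"
  shows "\<exists>C. root_component G C \<and> (\<forall>u\<in>C. (u, v) \<in> (parcs G)\<^sup>*)"
proof -
  interpret pair_wf_digraph G by fact
  define pred where "pred u = {w. (w, u) \<in> (parcs G)\<^sup>*}" for u
  have closed: "w \<in> pverts G" if "(w, u) \<in> (parcs G)\<^sup>*" "u \<in> pverts G" for w u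
    using that by (induction rule: converse_rtrancl_induct) (auto dest: wellformed')
  obtain u where u: "(u, v) \<in> (parcs G)\<^sup>*"
    and least: "\<And>w. (w, v) \<in> (parcs G)\<^sup>* \<Longrightarrow> card (pred u) \<le> card (pred w)"
    using ex_has_least_nat[of "\<lambda>u. (u, v) \<in> (parcs G)\<^sup>*" v "\<lambda>u. card (pred u)"] by auto
  have uV: "u \<in> pverts G" using closed u v by blast
  have predV: "pred u \<subseteq> pverts G" using closed uV by (auto simp: pred_def)
  have returns: "(u, w) \<in> (parcs G)\<^sup>*" if "(w, u) \<in> (parcs G)\<^sup>*" for w
  proof -
    have sub: "pred w \<subseteq> pred u" using that by (auto simp: pred_def)
    moreover have "card (pred u) \<le> card (pred w)" using least that u by (meson rtrancl_trans)
    ultimately have "pred w = pred u"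
      using card_seteq finite_subset[OF predV fin] by blast
    then show ?thesis by (auto simp: pred_def)
  qed
  have "root_component G (pred u)"
    unfolding root_component_def in_sccs_verts_conv_reachable
  proof (intro conjI ballI allI impI)
    show "pred u \<noteq> {}" by (auto simp: pred_def)
  next
    fix a b assume "a \<in> pred u" "b \<in> pred u"
    then show "a \<rightarrow>\<^sup>*\<^bsub>with_proj G\<^esub> b"
      unfolding reachable_with_proj_iff[OF wf] using predV returns
      by (auto simp: pred_def intro: rtrancl_trans)
  next
    fix a b assume "a \<in> pred u" "b \<notin> pred u"
    then have "\<not> b \<rightarrow>\<^sup>*\<^bsub>with_proj G\<^esub> a"
      unfolding reachable_with_proj_iff[OF wf] by (auto simp: pred_def dest: rtrancl_trans)
    then show "\<not> a \<rightarrow>\<^sup>*\<^bsub>with_proj G\<^esub> b \<or> \<not> b \<rightarrow>\<^sup>*\<^bsub>with_proj G\<^esub> a" ..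
  next
    fix e assume "e \<in> parcs G"
    then show "case e of (q, p) \<Rightarrow> p \<in> pred u \<longrightarrow> q \<in> pred u"
      by (auto simp: pred_def intro: converse_rtrancl_into_rtrancl)
  qed
  moreover have "\<forall>w\<in>pred u. (w, v) \<in> (parcs G)\<^sup>*" using u by (auto simp: pred_def)
  ultimately show ?thesis by blast
qed

lemma Root_reaches:
  assumes "communication_graph P G" "finite P" "rooted G" "q \<in> Root G" "v \<in> P"
  shows "(q, v) \<in> (parcs G)\<^sup>*"
proof -
  obtain C where C: "root_component G C" "\<forall>u\<in>C. (u, v) \<in> (parcs G)\<^sup>*"
    using ex_root_component_reaching[of G v] assms by (auto simp: communication_graph_def)
  then have "Root G = C" using assms(3) unfolding rooted_def Root_def by (simp add: the1_equality)
  then show ?thesis using C assms by auto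
qed

lemma Root_subset:
  assumes "communication_graph P G" "rooted G"
  shows "Root G \<subseteq> P"
proof -
  interpret pair_wf_digraph G using assms(1) by (simp add: communication_graph_def)
  have "root_component G (Root G)"
    using assms(2) unfolding rooted_def Root_def by (rule theI')
  then show ?thesis
    using sccs_verts_subsets assms(1) by (auto simp: root_component_def communication_graph_def)
qed

text \<open>A path from the root process \<open>q\<close> to \<open>v\<close> has to cross from
  \<open>I\<close> to its complement. This is what makes the set of informed processes grow.\<close>

lemma Root_leaves:
  assumes "communication_graph P G" "finite P" "rooted G" "q \<in> Root G" "q \<in> I" "v \<in> P - I"
  obtains a b where "a \<in> I" "b \<in> P - I" "a \<in> In G b"
proof -
  have "(q, v) \<in> (parcs G)\<^sup>*" using Root_reaches assms by fastforce
  then have "v \<in> I \<or> (\<exists>a b. a \<in> I \<and> b \<notin> I \<and> (a, b) \<in> parcs G)"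
    using \<open>q \<in> I\<close> by (induction rule: rtrancl_induct) auto
  moreover have "pair_wf_digraph G" "pverts G = P"
    using assms(1) by (auto simp: communication_graph_def)
  ultimately show thesis
    using that assms(6) by (auto simp: In_def dest: pair_wf_digraph.wellformed')
qed

section \<open>Causal influence between process-time pairs\<close>

text \<open>These are the paths of the time-expanded graph. The source is a fixed parameter, so
  induction extends a path at its later end.\<close>

inductive influence :: "(nat \<Rightarrow> 'p cgraph) \<Rightarrow> nat \<Rightarrow> 'p \<Rightarrow> nat \<Rightarrow> 'p \<Rightarrow> bool"
  for \<sigma> t q where
  influence_refl: "influence \<sigma> t q t q"
| influence_step: "influence \<sigma> t q r p \<Longrightarrow> p \<in> In (\<sigma> (Suc r)) p' \<Longrightarrow> influence \<sigma> t q (Suc r) p'"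

lemma view_of_eq_process: "view_of \<sigma> x r p = view_of \<tau> y r' q \<Longrightarrow> p = q"
  by (cases r; cases r') auto

lemma view_of_eq_round: "view_of \<sigma> x r p = view_of \<tau> y r' q \<Longrightarrow> r = r'"
  by (cases r; cases r') auto

locale adversary =
  fixes P :: "'p set" and D :: "'p cgraph set"
  assumes finite_P: "finite P" and adv: "message_adversary P D"
begin

lemma cgraph: "G \<in> D \<Longrightarrow> communication_graph P G"
  using adv by (simp add: message_adversary_def)

lemma admissible_cgraph: "admissible D \<sigma> \<Longrightarrow> t \<ge> 1 \<Longrightarrow> communication_graph P (\<sigma> t)"
  using cgraph by (auto simp: admissible_def)

lemma In_subset: "G \<in> D \<Longrightarrow> In G p \<subseteq> P"
  using cgraph[of G] by (auto simp: In_def communication_graph_def dest: pair_wf_digraph.wellformed')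

lemma self_In: "G \<in> D \<Longrightarrow> p \<in> P \<Longrightarrow> p \<in> In G p"
  using cgraph[of G] by (auto simp: In_def communication_graph_def)

lemma influence_self:
  assumes "admissible D \<sigma>" "p \<in> P" "t \<le> r"
  shows "influence \<sigma> t p r p"
  using assms(3)
proof (induction r rule: dec_induct)
  case (step r)
  then show ?case using self_In[of "\<sigma> (Suc r)" p] assms
    by (auto intro: influence_step simp: admissible_def)
qed (auto intro: influence_refl)

section \<open>Views determine the causal past\<close>

lemma view_eq_In:
  assumes "admissible D \<sigma>" "admissible D \<tau>"
    and "view_of \<sigma> x (Suc r) p = view_of \<tau> y (Suc r) p"
    and "q \<in> In (\<sigma> (Suc r)) p"
  shows "q \<in> In (\<tau> (Suc r)) p \<and> view_of \<sigma> x r q = view_of \<tau> y r q"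
proof -
  \<comment> \<open>\<open>Abs_fset\<close> is injective on finite sets only.\<close>
  have fin: "finite {view_of \<rho> z r q |q. q \<in> In (\<rho> (Suc r)) p}" if "admissible D \<rho>" for \<rho> z
  proof -
    have "finite (In (\<rho> (Suc r)) p)"
      using that by (intro finite_subset[OF In_subset finite_P]) (simp add: admissible_def)
    then show ?thesis by simp
  qed
  have "{view_of \<sigma> x r q |q. q \<in> In (\<sigma> (Suc r)) p} = {view_of \<tau> y r q |q. q \<in> In (\<tau> (Suc r)) p}"
    using assms(3) fin[OF assms(1), of x] fin[OF assms(2), of y] by (simp add: Abs_fset_inject)
  then have "view_of \<sigma> x r q \<in> {view_of \<tau> y r q |q. q \<in> In (\<tau> (Suc r)) p}"
    using assms(4) by blast
  then show ?thesis by (auto dest: view_of_eq_process)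
qed

text \<open>A view contains the views of its in-neighbours, so equality of views descends along a
  causal path to its earlier end.\<close>

lemma view_eq_influence:
  assumes "influence \<sigma> t q r p" and adm: "admissible D \<sigma>" "admissible D \<tau>"
    and "view_of \<sigma> x r p = view_of \<tau> y r p"
  shows "influence \<tau> t q r p \<and> view_of \<sigma> x t q = view_of \<tau> y t q"
  using assms(1,4)
proof (induction rule: influence.induct)
  case influence_refl
  then show ?case by (auto intro: influence.influence_refl)
next
  case (influence_step r p p')
  then show ?case using view_eq_In[OF adm] by (meson influence.influence_step)
qed

text \<open>The graph part of an equality of views, with the inputs forgotten, so that chains of
  indistinguishable runs can be studied without inputs. Rounds start at 1, hence
  \<open>Suc t\<close>.\<close>

definition same_past :: "nat \<Rightarrow> 'p \<Rightarrow> (nat \<Rightarrow> 'p cgraph) \<Rightarrow> (nat \<Rightarrow> 'p cgraph) \<Rightarrow> bool" where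
  "same_past r p \<sigma> \<tau> \<longleftrightarrow>
     (\<forall>t q. influence \<sigma> t q r p \<longleftrightarrow> influence \<tau> t q r p) \<and>
     (\<forall>t q. influence \<sigma> (Suc t) q r p \<longrightarrow> In (\<sigma> (Suc t)) q = In (\<tau> (Suc t)) q)"

lemma view_eq_same_past:
  assumes adm: "admissible D \<sigma>" "admissible D \<tau>"
    and eq: "view_of \<sigma> x r p = view_of \<tau> y r p"
  shows "same_past r p \<sigma> \<tau>"
  unfolding same_past_def
proof (intro conjI allI impI)
  fix t q show "influence \<sigma> t q r p \<longleftrightarrow> influence \<tau> t q r p"
    using view_eq_influence adm eq by metis
next
  fix t q assume "influence \<sigma> (Suc t) q r p"
  then have "view_of \<sigma> x (Suc t) q = view_of \<tau> y (Suc t) q"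
    using view_eq_influence adm eq by metis
  then show "In (\<sigma> (Suc t)) q = In (\<tau> (Suc t)) q"
    using view_eq_In adm by (metis subset_antisym subsetI)
qed

definition indist :: "nat \<Rightarrow> (nat \<Rightarrow> 'p cgraph) \<Rightarrow> (nat \<Rightarrow> 'p cgraph) \<Rightarrow> bool" where
  "indist r \<sigma> \<tau> \<longleftrightarrow> admissible D \<sigma> \<and> admissible D \<tau> \<and> (\<exists>p\<in>P. same_past r p \<sigma> \<tau>)"

lemma indist_sym: "indist r \<sigma> \<tau> \<Longrightarrow> indist r \<tau> \<sigma>"
  unfolding indist_def same_past_def by metis

lemma indist_admissible: "(indist r)\<^sup>*\<^sup>* \<sigma> \<tau> \<Longrightarrow> admissible D \<sigma> \<Longrightarrow> admissible D \<tau>"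
  by (induction rule: rtranclp_induct) (auto simp: indist_def)

text \<open>Each round of \<open>T\<close> enlarges the set of processes influenced by \<open>q\<close>, until it is \<open>P\<close>.\<close>
lemma influence_all:
  assumes adm: "admissible D \<sigma>" and T: "T \<subseteq> {t<..r}" "card P \<le> card T"
    and root: "\<And>s. s \<in> T \<Longrightarrow> rooted (\<sigma> s) \<and> q \<in> Root (\<sigma> s)"
    and "q \<in> P" "p \<in> P"
  shows "influence \<sigma> t q r p"
proof -
  define I where "I s = {p \<in> P. influence \<sigma> t q s p}" for s
  have finI: "finite (I s)" for s using finite_P by (auto simp: I_def)
  have grow: "I s \<subseteq> I (Suc s)" for s
    using adm self_In by (auto simp: I_def admissible_def intro: influence_step)
  have qI: "q \<in> I s" if "t \<le> s" for s
    using influence_self[OF adm \<open>q \<in> P\<close> that] \<open>q \<in> P\<close> by (simp add: I_def)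
  \<comment> \<open>The additional one counts \<open>q\<close> itself, present from time
    \<open>t\<close>. At time \<open>r\<close> the second alternative would give more than
    \<open>card P\<close> processes.\<close>
  have *: "t \<le> s \<Longrightarrow> I s = P \<or> Suc (card (T \<inter> {..s})) \<le> card (I s)" for s
  proof (induction s rule: dec_induct)
    case base
    have "T \<inter> {..t} = {}" using T by auto
    moreover have "card (I t) \<noteq> 0" using qI[of t] finI[of t] by auto
    ultimately show ?case by simp
  next
    case (step s)
    show ?case
    proof (cases "I (Suc s) = P")
      case False
      then have ne: "I s \<noteq> P" using grow[of s] by (auto simp: I_def)
      with step have IH: "Suc (card (T \<inter> {..s})) \<le> card (I s)" by simp
      show ?thesis
      proof (cases "Suc s \<in> T")
        case True
        have c: "communication_graph P (\<sigma> (Suc s))" using admissible_cgraph[OF adm] by simp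
        obtain v where "v \<in> P - I s" using ne by (auto simp: I_def)
        then obtain a b where ab: "a \<in> I s" "b \<in> P - I s" "a \<in> In (\<sigma> (Suc s)) b"
          using Root_leaves[OF c finite_P, of q "I s" v] root[OF True] qI step by auto
        then have "b \<in> I (Suc s)" by (auto simp: I_def intro: influence_step)
        with ab grow[of s] have "I s \<subset> I (Suc s)" by auto
        then have "card (I s) < card (I (Suc s))" using finI psubset_card_mono by blast
        moreover have "T \<inter> {..Suc s} = insert (Suc s) (T \<inter> {..s})" using True by auto
        ultimately show ?thesis using IH by simp
      next
        case False
        then have "T \<inter> {..Suc s} = T \<inter> {..s}" by (auto simp: le_Suc_eq)
        then show ?thesis using IH card_mono[OF finI grow, of s] by simp
      qed
    qed simp
  qed
  have "T \<noteq> {}" using assms(6) T finite_P by auto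
  then have "t \<le> r" using T by auto
  moreover have "T \<inter> {..r} = T" using T by auto
  moreover have "card (I r) \<le> card P" using finite_P by (auto simp: I_def intro: card_mono)
  ultimately have "I r = P" using *[of r] T by auto
  then show ?thesis using \<open>p \<in> P\<close> by (auto simp: I_def)
qed

end

section \<open>The refinement as a sequence of symmetric graphs\<close>

lemma refinement_Suc: "i \<ge> 1 \<Longrightarrow> refinement P D (Suc i) = refine P (refinement P D i)"
  by (cases i) (simp_all add: refinement_def)

lemma pverts_refinement [simp]: "pverts (refinement P D i) = D"
proof -
  have "pverts ((refine P ^^ j) (indist_graph P D)) = D" for j
    by (induction j) (simp_all add: refine_def indist_graph_def)
  then show ?thesis by (simp add: refinement_def)
qed

lemma parcs_refinement_subset: "parcs (refinement P D i) \<subseteq> D \<times> D"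
proof -
  have "parcs ((refine P ^^ j) (indist_graph P D)) \<subseteq> D \<times> D" for j
    by (induction j) (auto simp: refine_def indist_graph_def)
  then show ?thesis by (simp add: refinement_def)
qed

lemma wf_refinement: "pair_wf_digraph (refinement P D i)"
  using parcs_refinement_subset[of P D i] by unfold_locales auto

lemma sym_refinement: "sym (parcs (refinement P D i))"
proof -
  have "sym (parcs (refinement P D (Suc j)))" for j
  proof (induction j)
    case 0
    then show ?case using indist_graph_symmetric by (simp add: refinement_def)
  next
    case (Suc j)
    then show ?case using refine_symmetric[of "refinement P D (Suc j)"] parcs_refinement_subset[of P D "Suc j"]
      by (simp add: refinement_Suc[of "Suc j"])
  qed
  then show ?thesis
    using indist_graph_symmetric by (cases i) (auto simp: refinement_def)
qed

abbreviation component :: "'p cgraph pair_pre_digraph \<Rightarrow> 'p cgraph \<Rightarrow> 'p cgraph set" where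
  "component N \<equiv> pre_digraph.scc_of (with_proj N)"

lemma component_eqI:
  assumes wf: "pair_wf_digraph N" and "sym (parcs N)" and "(G, H) \<in> parcs N"
  shows "component N G = component N H"
proof -
  interpret pair_wf_digraph N by fact
  have "(H, G) \<in> parcs N" using assms by (auto dest: symD)
  then have "H \<rightarrow>\<^sup>*\<^bsub>with_proj N\<^esub> G" "G \<rightarrow>\<^sup>*\<^bsub>with_proj N\<^esub> H" using assms(3) by auto
  then show ?thesis unfolding scc_of_def by (auto intro: reachable_trans)
qed

lemma in_component_self:
  assumes "pair_wf_digraph N" "G \<in> pverts N"
  shows "G \<in> component N G"
proof -
  interpret pair_wf_digraph N by fact
  show ?thesis using in_scc_of_self assms by simp
qed

section \<open>Root-compatible components suffice for consensus\<close>

context adversary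
begin

lemma finite_D: "finite D" and D_nonempty: "D \<noteq> {}"
  using finite_message_adversary[OF finite_P adv] adv by (auto simp: message_adversary_def)

text \<open>The last conjunct makes the induction over the refinements work: two graphs of one
  component of \<open>N\<close> need not be adjacent in \<open>N\<close>, but only edges of \<open>N\<close> can survive.\<close>
definition locked ::
  "'p cgraph pair_pre_digraph \<Rightarrow> nat \<Rightarrow> (nat \<Rightarrow> 'p cgraph) \<Rightarrow> nat set \<Rightarrow> 'p cgraph set \<Rightarrow> bool" where
  "locked N r \<sigma> T C \<longleftrightarrow> T \<subseteq> {1..r} \<and>
     (\<forall>\<tau>. (indist r)\<^sup>*\<^sup>* \<sigma> \<tau> \<longrightarrow> (\<forall>t\<in>T. component N (\<tau> t) = C)) \<and>
     (\<forall>\<tau> \<rho>. (indist r)\<^sup>*\<^sup>* \<sigma> \<tau> \<longrightarrow> indist r \<tau> \<rho> \<longrightarrow> (\<forall>t\<in>T. \<tau> t = \<rho> t \<or> (\<tau> t, \<rho> t) \<in> parcs N))"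

text \<open>Between indistinguishable runs, round \<open>t\<close> stays put or moves along an arc
  of \<open>N\<close>, so it never leaves its component. There are at most \<open>card D\<close>
  components, so one of them holds \<open>M\<close> rounds of \<open>T\<close>.\<close>

lemma ex_locked:
  assumes N: "pair_wf_digraph N" "sym (parcs N)" "pverts N = D"
    and adm: "admissible D \<sigma>" and T: "T \<subseteq> {1..r}" "M * card D \<le> card T"
    and step: "\<And>\<tau> \<rho> t. (indist r)\<^sup>*\<^sup>* \<sigma> \<tau> \<Longrightarrow> indist r \<tau> \<rho> \<Longrightarrow> t \<in> T \<Longrightarrow>
                 \<tau> t = \<rho> t \<or> (\<tau> t, \<rho> t) \<in> parcs N"
  shows "\<exists>T C. locked N r \<sigma> T C \<and> M \<le> card T"
proof -
  let ?f = "\<lambda>t. component N (\<sigma> t)"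
  have finT: "finite T" using T finite_subset by blast
  have "M * card (component N ` D) \<le> M * card D" by (intro mult_le_mono2 card_image_le finite_D)
  then have "M * card (component N ` D) \<le> card T" using T(2) by linarith
  moreover have "?f ` T \<subseteq> component N ` D" using adm T by (auto simp: admissible_def)
  ultimately obtain C where C: "M \<le> card {t\<in>T. ?f t = C}"
    using pigeonhole_fiber[of T "component N ` D" ?f M] finT finite_D D_nonempty by auto
  have "component N (\<tau> t) = ?f t" if "(indist r)\<^sup>*\<^sup>* \<sigma> \<tau>" "t \<in> T" for \<tau> t
    using that(1)
  proof (induction rule: rtranclp_induct)
    case (step \<tau> \<rho>)
    then show ?case using assms(7)[of \<tau> \<rho> t] component_eqI[OF N(1,2)] that(2) by metis
  qed simp
  then have "locked N r \<sigma> {t\<in>T. ?f t = C} C"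
    using T step unfolding locked_def by auto
  then show ?thesis using C by blast
qed

lemma same_past_label:
  assumes "same_past r p \<sigma> \<tau>" "influence \<sigma> t q r p" "q \<in> P" "1 \<le> t"
  shows "q \<in> label P (\<sigma> t) (\<tau> t)"
  using assms unfolding same_past_def label_def by (cases t) auto

text \<open>\<open>M\<close> is arbitrary in the induction because each refinement consumes rounds:
  out of \<open>M * card D + card P * card D\<close> locked rounds, the first
  \<open>M * card D\<close> keep their edges and the others let information spread. Pigeonhole over
  components then leaves \<open>M\<close> of the early ones.\<close>

lemma ex_locked_refinement:
  assumes rooted: "\<And>G. G \<in> D \<Longrightarrow> rooted G"
  shows "\<exists>r. \<forall>\<sigma>. admissible D \<sigma> \<longrightarrow> (\<exists>T C. locked (refinement P D (Suc i)) r \<sigma> T C \<and> M \<le> card T)"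
proof (induction i arbitrary: M)
  case 0
  let ?N = "refinement P D (Suc 0)"
  show ?case
  proof (intro exI[of _ "M * card D"] allI impI)
    fix \<sigma> assume adm: "admissible D \<sigma>"
    let ?r = "M * card D"
    have "\<tau> t = \<rho> t \<or> (\<tau> t, \<rho> t) \<in> parcs ?N" if ind: "indist ?r \<tau> \<rho>" and t: "t \<in> {1..?r}" for \<tau> \<rho> t
    proof -
      obtain p where p: "p \<in> P" "same_past ?r p \<tau> \<rho>" and a: "admissible D \<tau>" "admissible D \<rho>"
        using ind unfolding indist_def by blast
      \<comment> \<open>Self-loops carry the state of \<open>p\<close> from round \<open>t\<close>
        to the end, so \<open>p\<close> itself always lies in the label.\<close>
      have "p \<in> label P (\<tau> t) (\<rho> t)"
        using same_past_label[OF p(2) influence_self[OF a(1) p(1)] p(1)] t by simp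
      then show ?thesis using a t by (auto simp: refinement_def indist_graph_def admissible_def)
    qed
    then show "\<exists>T C. locked ?N ?r \<sigma> T C \<and> M \<le> card T"
      by (intro ex_locked[of _ _ "{1..?r}"] wf_refinement sym_refinement adm) auto
  qed
next
  case (Suc i)
  let ?N = "refinement P D (Suc i)" and ?N' = "refinement P D (Suc (Suc i))"
  obtain r where r: "\<And>\<sigma>. admissible D \<sigma> \<Longrightarrow>
      \<exists>T C. locked ?N r \<sigma> T C \<and> M * card D + card P * card D \<le> card T"
    using Suc.IH[of "M * card D + card P * card D"] by blast
  show ?case
  proof (intro exI[of _ r] allI impI)
    fix \<sigma> assume adm: "admissible D \<sigma>"
    obtain T C where l: "locked ?N r \<sigma> T C" and card: "M * card D + card P * card D \<le> card T"
      using r[OF adm] by blast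
    have T: "T \<subseteq> {1..r}" using l by (simp add: locked_def)
    then have finT: "finite T" using finite_subset by blast
    obtain s where s: "card (T \<inter> {..<s}) = M * card D"
      using ex_initial_segment_card[OF finT, of "M * card D"] card by auto
    have "card T = card (T \<inter> {..<s}) + card (T - {..<s})"
      using finT by (metis card_Int_Diff)
    then have late: "card P * card D \<le> card (T - {..<s})" using s card by simp
    have "\<tau> t = \<rho> t \<or> (\<tau> t, \<rho> t) \<in> parcs ?N'"
      if \<tau>: "(indist r)\<^sup>*\<^sup>* \<sigma> \<tau>" and \<rho>: "indist r \<tau> \<rho>" and t: "t \<in> T \<inter> {..<s}" for \<tau> \<rho> t
    proof (cases "\<tau> t = \<rho> t")
      case False
      have arc: "(\<tau> t, \<rho> t) \<in> parcs ?N" using l \<tau> \<rho> t False unfolding locked_def by blast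
      obtain p where p: "p \<in> P" "same_past r p \<tau> \<rho>" and a: "admissible D \<tau>" "admissible D \<rho>"
        using \<rho> unfolding indist_def by blast
      have "\<tau> ` (T - {..<s}) \<subseteq> D" using a T by (auto simp: admissible_def)
      then obtain K where K: "K \<in> D" "card P \<le> card {u \<in> T - {..<s}. \<tau> u = K}"
        using pigeonhole_fiber[OF _ finite_D D_nonempty _ late] finT by blast
      have "card P \<noteq> 0" using p finite_P by auto
      then have "{u \<in> T - {..<s}. \<tau> u = K} \<noteq> {}" using K(2) by (metis card.empty le_zero_eq)
      then obtain u where u: "u \<in> T" "\<tau> u = K" by auto
      have "component ?N K = component ?N (\<tau> t)"
        using l \<tau> u t unfolding locked_def by blast
      then have Kin: "K \<in> component ?N (\<tau> t)"
        using in_component_self[OF wf_refinement, of K P D "Suc i"] K by simp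
      \<comment> \<open>The late rounds with graph \<open>K\<close> all follow \<open>t\<close> and
        number at least \<open>card P\<close>, so \<open>p\<close> hears by time \<open>r\<close>
        from every \<open>q\<close> in \<open>Root K\<close> as of round \<open>t\<close>, and knows
        its in-neighbourhood there.\<close>
      have "Root K \<subseteq> label P (\<tau> t) (\<rho> t)"
      proof
        fix q assume q: "q \<in> Root K"
        then have "q \<in> P" using Root_subset[OF cgraph rooted] K by blast
        moreover have "influence \<tau> t q r p"
          using K q T t rooted[OF K(1)]
          by (intro influence_all[OF a(1) _ K(2) _ \<open>q \<in> P\<close> p(1)]) auto
        ultimately show "q \<in> label P (\<tau> t) (\<rho> t)"
          using same_past_label[OF p(2)] t T by auto
      qed
      then have "(\<tau> t, \<rho> t) \<in> parcs (refine P ?N)"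
        using arc Kin by (auto simp: refine_def)
      then show ?thesis by (simp add: refinement_Suc)
    qed simp
    then show "\<exists>T C. locked ?N' r \<sigma> T C \<and> M \<le> card T"
      using s T by (intro ex_locked[of _ _ "T \<inter> {..<s}"] wf_refinement sym_refinement adm) auto
  qed
qed

text \<open>The rounds of \<open>T\<close> stay in one component \<open>C\<close> throughout a class
  of runs, and a process common to all roots of \<open>C\<close> reaches everybody within
  \<open>card P\<close> such rounds. Thus one \<open>q\<close> serves the whole class.\<close>

lemma ex_common_broadcaster:
  assumes "P \<noteq> {}"
    and comp: "\<And>C. C \<in> pre_digraph.sccs_verts (with_proj (refinement P D (Suc i))) \<Longrightarrow> root_compatible C"
  shows "\<exists>r. \<forall>\<sigma>. admissible D \<sigma> \<longrightarrow>
           (\<exists>q\<in>P. \<forall>\<tau>. (indist r)\<^sup>*\<^sup>* \<sigma> \<tau> \<longrightarrow> (\<forall>p\<in>P. influence \<tau> 0 q r p))"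
proof -
  let ?N = "refinement P D (Suc i)"
  interpret N: pair_wf_digraph ?N by (rule wf_refinement)
  have compat: "root_compatible (component ?N G)" if "G \<in> D" for G
    using comp N.scc_of_in_sccs_verts that by simp
  have inN: "G \<in> component ?N G" if "G \<in> D" for G
    using that by (intro in_component_self wf_refinement) simp
  have rooted: "rooted G" if "G \<in> D" for G
    using compat inN that by (auto simp: root_compatible_def)
  obtain r where r: "\<And>\<sigma>. admissible D \<sigma> \<Longrightarrow> \<exists>T C. locked ?N r \<sigma> T C \<and> card P \<le> card T"
    using ex_locked_refinement[OF rooted, of i "card P"] by blast
  show ?thesis
  proof (intro exI[of _ r] allI impI)
    fix \<sigma> assume adm: "admissible D \<sigma>"
    obtain T C where l: "locked ?N r \<sigma> T C" and card: "card P \<le> card T" using r[OF adm] by blast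
    have T: "T \<subseteq> {1..r}" using l by (simp add: locked_def)
    have C: "component ?N (\<tau> t) = C" if "(indist r)\<^sup>*\<^sup>* \<sigma> \<tau>" "t \<in> T" for \<tau> t
      using l that unfolding locked_def by blast
    have "T \<noteq> {}" using card assms(1) finite_P by auto
    then obtain t where t: "t \<in> T" by auto
    then have \<sigma>t: "\<sigma> t \<in> D" using adm T by (auto simp: admissible_def)
    then have "root_compatible C" using C[of \<sigma>] t compat by force
    then obtain q where q: "\<And>G. G \<in> C \<Longrightarrow> q \<in> Root G" by (auto simp: root_compatible_def)
    have "\<sigma> t \<in> C" using C[of \<sigma>] t inN[OF \<sigma>t] by simp
    then have qP: "q \<in> P" using q Root_subset[OF cgraph rooted] \<sigma>t by blast
    have "influence \<tau> 0 q r p" if \<tau>: "(indist r)\<^sup>*\<^sup>* \<sigma> \<tau>" and "p \<in> P" for \<tau> p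
    proof (rule influence_all[OF _ _ card _ qP \<open>p \<in> P\<close>])
      show a: "admissible D \<tau>" using indist_admissible \<tau> adm by blast
      show "T \<subseteq> {0<..r}" using T by auto
      fix s assume s: "s \<in> T"
      then have "\<tau> s \<in> D" using a T by (auto simp: admissible_def)
      moreover from this have "\<tau> s \<in> C" using C[OF \<tau> s] inN by blast
      ultimately show "rooted (\<tau> s) \<and> q \<in> Root (\<tau> s)" using q rooted by blast
    qed
    then show "\<exists>q\<in>P. \<forall>\<tau>. (indist r)\<^sup>*\<^sup>* \<sigma> \<tau> \<longrightarrow> (\<forall>p\<in>P. influence \<tau> 0 q r p)"
      using qP by blast
  qed
qed

text \<open>The choice depends on the class \<open>cls \<sigma>\<close> alone, so indistinguishable
  runs receive the same leader.\<close>

lemma ex_leader: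
  assumes "\<And>\<sigma>. admissible D \<sigma> \<Longrightarrow>
           \<exists>q\<in>P. \<forall>\<tau>. (indist r)\<^sup>*\<^sup>* \<sigma> \<tau> \<longrightarrow> (\<forall>p\<in>P. influence \<tau> 0 q r p)"
  shows "\<exists>ld. (\<forall>\<sigma>. admissible D \<sigma> \<longrightarrow> ld \<sigma> \<in> P \<and> (\<forall>p\<in>P. influence \<sigma> 0 (ld \<sigma>) r p)) \<and>
              (\<forall>\<sigma> \<tau>. indist r \<sigma> \<tau> \<longrightarrow> ld \<sigma> = ld \<tau>)"
proof -
  define cls where "cls \<sigma> = {\<tau>. (indist r)\<^sup>*\<^sup>* \<sigma> \<tau>}" for \<sigma>
  define ld where "ld \<sigma> = (SOME q. q \<in> P \<and> (\<forall>\<tau>\<in>cls \<sigma>. \<forall>p\<in>P. influence \<tau> 0 q r p))" for \<sigma>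
  have "ld \<sigma> \<in> P \<and> (\<forall>\<tau>\<in>cls \<sigma>. \<forall>p\<in>P. influence \<tau> 0 (ld \<sigma>) r p)" if "admissible D \<sigma>" for \<sigma>
    unfolding ld_def by (rule someI_ex) (use assms[OF that] in \<open>auto simp: cls_def\<close>)
  moreover have "cls \<sigma> = cls \<tau>" if "indist r \<sigma> \<tau>" for \<sigma> \<tau>
    using that indist_sym[OF that] unfolding cls_def
    by (auto intro: converse_rtranclp_into_rtranclp)
  ultimately show ?thesis
    by (intro exI[of _ ld] conjI allI impI) (auto simp: cls_def ld_def)
qed

text \<open>In round \<open>r\<close> everybody decides on the input of the leader. The view at that
  time fixes the class of the run, hence the leader, and contains the leader's input, so the
  decision is a function of the view.\<close>

theorem consensus_solvable_if_root_compatible: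
  fixes V :: "'v set"
  assumes "P \<noteq> {}"
    and comp: "\<And>C. C \<in> pre_digraph.sccs_verts (with_proj (refinement P D (Suc i))) \<Longrightarrow> root_compatible C"
  shows "consensus_solvable P V D"
proof -
  obtain r ld where lead: "\<And>\<sigma> p. admissible D \<sigma> \<Longrightarrow> ld \<sigma> \<in> P"
      "\<And>\<sigma> p. admissible D \<sigma> \<Longrightarrow> p \<in> P \<Longrightarrow> influence \<sigma> 0 (ld \<sigma>) r p"
    and lead_eq: "\<And>\<sigma> \<tau>. indist r \<sigma> \<tau> \<Longrightarrow> ld \<sigma> = ld \<tau>"
    using ex_common_broadcaster[OF assms] ex_leader by metis
  \<comment> \<open>Views of all rounds from \<open>r\<close> on are covered, so that the decision
    persists.\<close>
  define run where "run p w \<sigma> x \<longleftrightarrow> admissible D \<sigma> \<and> (\<exists>r'\<ge>r. w = view_of \<sigma> x r' p)"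
    for p w \<sigma> and x :: "'p \<Rightarrow> 'v"
  define \<Delta> where "\<Delta> p w =
      (if \<exists>\<sigma> x. run p w \<sigma> x then Some (SOME v. \<exists>\<sigma> x. run p w \<sigma> x \<and> v = x (ld \<sigma>)) else None)" for p w
  have unique: "x (ld \<sigma>) = y (ld \<tau>)" if "p \<in> P" and runs: "run p w \<sigma> x" "run p w \<tau> y" for p w \<sigma> \<tau> x y
  proof -
    obtain r' r'' where r': "r \<le> r'" and w: "w = view_of \<sigma> x r' p" "w = view_of \<tau> y r'' p"
      and a: "admissible D \<sigma>" "admissible D \<tau>"
      using runs unfolding run_def by blast
    have "r' = r''" using w by (metis view_of_eq_round)
    then have eq: "view_of \<sigma> x r' p = view_of \<tau> y r' p" using w by simp
    \<comment> \<open>The leader was chosen for horizon \<open>r\<close>, and the later view of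
      \<open>p\<close> still contains its view of round \<open>r\<close>.\<close>
    have eqr: "view_of \<sigma> x r p = view_of \<tau> y r p"
      using view_eq_influence[OF influence_self a eq] a \<open>p \<in> P\<close> r' by blast
    then have "indist r \<sigma> \<tau>"
      using view_eq_same_past a \<open>p \<in> P\<close> unfolding indist_def by blast
    then have "ld \<sigma> = ld \<tau>" by (rule lead_eq)
    moreover have "view_of \<sigma> x 0 (ld \<sigma>) = view_of \<tau> y 0 (ld \<sigma>)"
      using view_eq_influence[OF lead(2) a eqr] a \<open>p \<in> P\<close> by blast
    ultimately show ?thesis by simp
  qed
  have late: "\<Delta> p (view_of \<sigma> x r' p) = Some (x (ld \<sigma>))"
    if "p \<in> P" "admissible D \<sigma>" "r \<le> r'" for p \<sigma> x r'
  proof -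
    have run: "run p (view_of \<sigma> x r' p) \<sigma> x" using that by (auto simp: run_def)
    then have "(SOME v. \<exists>\<tau> y. run p (view_of \<sigma> x r' p) \<tau> y \<and> v = y (ld \<tau>)) = x (ld \<sigma>)"
      using unique[OF \<open>p \<in> P\<close>] by (intro some_equality) blast+
    then show ?thesis using run by (auto simp: \<Delta>_def)
  qed
  have early: "\<Delta> p (view_of \<sigma> x r' p) = None" if "r' < r" for p \<sigma> x r'
    using that view_of_eq_round unfolding \<Delta>_def run_def by (metis not_le)
  have \<Delta>: "\<Delta> p (view_of \<sigma> x r' p) = (if r \<le> r' then Some (x (ld \<sigma>)) else None)"
    if "p \<in> P" "admissible D \<sigma>" for p \<sigma> x r'
    using late[OF that] early by simp
  have "consensus_algorithm P V D \<Delta>"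
    unfolding consensus_algorithm_def using \<Delta> lead(1) by (auto simp: input_assignment_def)
  moreover have dec: "decides \<Delta> \<sigma> x p v \<longleftrightarrow> v = x (ld \<sigma>)" if "p \<in> P" "admissible D \<sigma>" for \<sigma> x p v
    unfolding decides_def using \<Delta>[OF that] by auto
  have "correct_under P V D \<Delta>"
    unfolding correct_under_def satisfies_termination_def satisfies_agreement_def satisfies_validity_def
    using dec lead(1) by auto
  ultimately show ?thesis unfolding consensus_solvable_def by blast
qed

end

section \<open>Chains of communication graphs\<close>

text \<open>
  \<open>R j\<close> is going to be the root of the \<open>j\<close>-th graph. The graphs \<open>j\<close> and \<open>Suc j\<close> agree
  exactly on the in-neighbourhoods of \<open>R (j + 2)\<close>, and the covering condition makes the graph
  \<open>j + 2\<close> the only one that can support the edge between them.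
\<close>
locale root_chain =
  fixes P :: "'p set" and R :: "nat \<Rightarrow> 'p set" and m :: nat
  assumes finite_P: "finite P"
    and R_subset: "R i \<subseteq> P"
    and R_nonempty: "R i \<noteq> {}"
    and R_disjoint: "R i \<inter> R (Suc i) = {}" "R i \<inter> R (Suc (Suc i)) = {}"
    and R_cover: "i \<le> m \<Longrightarrow> j \<le> Suc m \<Longrightarrow> R i \<subseteq> insert q (R j \<union> R (Suc j)) \<Longrightarrow> i = j \<or> i = Suc j"
begin

text \<open>The first branch arranges agreement with graph \<open>j + 1\<close>, the second with
  graph \<open>j - 1\<close>: a member of \<open>R (j + 2)\<close> hears from itself,
  \<open>R j\<close> and \<open>R (j + 1)\<close> in both graph \<open>j\<close> and graph
  \<open>j + 1\<close>. The guard keeps graph 0, which has no predecessor, out of the second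
  branch.\<close>

definition nbrs :: "nat \<Rightarrow> 'p \<Rightarrow> 'p set" where
  "nbrs j q = insert q (R j \<union>
     (if q \<in> R (Suc (Suc j)) then R (Suc j)
      else if 1 \<le> j \<and> q \<in> R (Suc j) then R (j - 1) else {}))"

definition chain_graph :: "nat \<Rightarrow> 'p cgraph" where
  "chain_graph j = \<lparr> pverts = P, parcs = {(p, q). q \<in> P \<and> p \<in> nbrs j q} \<rparr>"

definition chain_graphs :: "'p cgraph set" where
  "chain_graphs = chain_graph ` {..m}"

lemma communication_graph_chain_graph: "communication_graph P (chain_graph j)"
proof -
  have "p \<in> P" if "p \<in> nbrs j q" "q \<in> P" for p q
    using that R_subset by (auto simp: nbrs_def split: if_splits)
  then have "pair_wf_digraph (chain_graph j)"
    by unfold_locales (auto simp: chain_graph_def)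
  moreover have "q \<in> nbrs j q" for q by (simp add: nbrs_def)
  ultimately show ?thesis by (auto simp: communication_graph_def chain_graph_def)
qed

sublocale adversary P chain_graphs
  by unfold_locales
     (auto simp: finite_P message_adversary_def chain_graphs_def communication_graph_chain_graph)

lemma In_chain_graph: "q \<in> P \<Longrightarrow> In (chain_graph j) q = nbrs j q"
  by (simp add: In_def chain_graph_def)

text \<open>Equality puts \<open>R i\<close> inside \<open>nbrs j q\<close>, which lies in
  \<open>q\<close> plus two consecutive sets. By \<open>R_cover\<close>, \<open>i\<close> is one of
  their two indices. As \<open>i < j\<close>, only the branch using \<open>R (j - 1)\<close>
  remains.\<close>

lemma nbrs_eq_iff:
  assumes "i < j" "j \<le> m"
  shows "nbrs i q = nbrs j q \<longleftrightarrow> j = Suc i \<and> q \<in> R (Suc j)"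
proof
  assume "nbrs i q = nbrs j q"
  then have sub: "R i \<subseteq> nbrs j q" by (auto simp: nbrs_def)
  show "j = Suc i \<and> q \<in> R (Suc j)"
  proof (rule ccontr)
    assume no: "\<not> ?thesis"
    show False
    proof (cases "q \<notin> R (Suc (Suc j)) \<and> 1 \<le> j \<and> q \<in> R (Suc j)")
      case True
      then have "R i \<subseteq> insert q (R (j - 1) \<union> R (Suc (j - 1)))"
        using sub by (auto simp: nbrs_def)
      then show False using R_cover[of i "j - 1" q] assms no True by auto
    next
      case False
      then have "R i \<subseteq> insert q (R j \<union> R (Suc j))"
        using sub by (auto simp: nbrs_def split: if_splits)
      then show False using R_cover[of i j q] assms by auto
    qed
  qed
next
  assume "j = Suc i \<and> q \<in> R (Suc j)"
  then show "nbrs i q = nbrs j q"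
    using R_disjoint[of "Suc j"] by (auto simp: nbrs_def)
qed

section \<open>Labels and roots of the chain graphs\<close>

lemma label_chain_graph:
  assumes "i < j" "j \<le> m"
  shows "label P (chain_graph i) (chain_graph j) = (if j = Suc i then R (Suc j) else {})"
proof -
  have "label P (chain_graph i) (chain_graph j) = {q \<in> P. j = Suc i \<and> q \<in> R (Suc j)}"
    using nbrs_eq_iff[OF assms] unfolding label_def by (intro Collect_cong) (metis In_chain_graph)
  then show ?thesis using R_subset[of "Suc j"] by auto
qed

lemma label_commute: "label P G H = label P H G"
  by (auto simp: label_def)

text \<open>Equal graphs would agree on all of \<open>P\<close>, but the label is empty or equals
  \<open>R (Suc j)\<close>, which misses the nonempty set \<open>R j\<close>.\<close>

lemma chain_graph_eq_iff:
  assumes "i \<le> m" "j \<le> m"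
  shows "chain_graph i = chain_graph j \<longleftrightarrow> i = j"
proof -
  have "chain_graph i \<noteq> chain_graph j" if "i < j" "j \<le> m" for i j
  proof
    assume "chain_graph i = chain_graph j"
    then have "label P (chain_graph i) (chain_graph j) = P" by (simp add: label_def)
    then have "P = R (Suc j) \<or> P = {}"
      using label_chain_graph[OF that] by (simp split: if_splits)
    then show False using R_subset[of j] R_nonempty[of j] R_disjoint(1)[of j] by blast
  qed
  then show ?thesis using assms by (metis linorder_neqE_nat)
qed

text \<open>\<open>R j\<close> hears only from itself and sends to everybody. A root component
  contains the in-neighbours of its members, hence meets \<open>R j\<close>.\<close>

lemma root_component_chain_graph_iff: "root_component (chain_graph j) C \<longleftrightarrow> C = R j"
proof -
  let ?G = "chain_graph j"
  interpret pair_wf_digraph ?G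
    using communication_graph_chain_graph by (auto simp: communication_graph_def)
  have inside: "nbrs j q = R j" if "q \<in> R j" for q
    using that R_disjoint[of j] by (auto simp: nbrs_def)
  have arc: "(p, q) \<in> parcs ?G" if "p \<in> R j" "q \<in> P" for p q
    using that by (auto simp: chain_graph_def nbrs_def)
  have closed: "p \<in> R j" if "(p, q) \<in> (parcs ?G)\<^sup>*" "q \<in> R j" for p q
    using that by (induction rule: converse_rtrancl_induct) (auto simp: chain_graph_def inside)
  have root: "root_component ?G (R j)"
    unfolding root_component_def in_sccs_verts_conv_reachable
      reachable_with_proj_iff[OF pair_wf_digraph_axioms]
  proof (intro conjI ballI allI impI)
    show "R j \<noteq> {}" by (rule R_nonempty)
  next
    fix u v assume "u \<in> R j" "v \<in> R j"
    then show "u \<in> pverts ?G" "(u, v) \<in> (parcs ?G)\<^sup>*"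
      using arc R_subset[of j] by (auto simp: chain_graph_def)
  next
    fix u v assume "u \<in> R j" "v \<notin> R j"
    then show "\<not> (u \<in> pverts ?G \<and> (u, v) \<in> (parcs ?G)\<^sup>*) \<or> \<not> (v \<in> pverts ?G \<and> (v, u) \<in> (parcs ?G)\<^sup>*)"
      using closed by blast
  next
    fix e assume "e \<in> parcs ?G"
    then show "case e of (q, p) \<Rightarrow> p \<in> R j \<longrightarrow> q \<in> R j" using inside by (auto simp: chain_graph_def)
  qed
  have "C = R j" if C: "root_component ?G C"
  proof -
    have "C \<in> sccs_verts" using C by (simp add: root_component_def)
    then have "C \<noteq> {}" "C \<subseteq> pverts ?G"
      using sccs_verts_subsets[of C] in_sccs_verts_conv_reachable[of C] by blast+
    then have "C \<noteq> {}" "C \<subseteq> P" by (simp_all add: chain_graph_def)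
    then obtain v where v: "v \<in> C" "v \<in> P" by blast
    obtain u where u: "u \<in> R j" using R_nonempty by auto
    have "u \<in> C" using arc[OF u v(2)] C v(1) by (auto simp: root_component_def)
    then show "C = R j"
      using sccs_verts_disjoint C root u by (auto simp: root_component_def)
  qed
  then show ?thesis using root by blast
qed

lemma rooted_chain_graph: "rooted (chain_graph j)"
  by (simp add: rooted_def root_component_chain_graph_iff)

lemma rooted_chain_graphs: "G \<in> chain_graphs \<Longrightarrow> rooted G"
  using rooted_chain_graph by (auto simp: chain_graphs_def)

lemma Root_chain_graph: "Root (chain_graph j) = R j"
  by (simp add: Root_def root_component_chain_graph_iff)

text \<open>Refinement deletes edges but no nodes, so the graphs beyond \<open>h\<close> stay as
  isolated nodes.\<close>

definition path :: "nat \<Rightarrow> 'p cgraph pair_pre_digraph" where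
  "path h = \<lparr> pverts = chain_graphs,
     parcs = {(chain_graph a, chain_graph b) |a b. a \<le> h \<and> b \<le> h \<and> (b = Suc a \<or> a = Suc b)} \<rparr>"

lemma path_arcI:
  "a \<le> h \<Longrightarrow> b \<le> h \<Longrightarrow> b = Suc a \<or> a = Suc b \<Longrightarrow> (chain_graph a, chain_graph b) \<in> parcs (path h)"
  unfolding path_def by auto

lemma wf_path: "h \<le> m \<Longrightarrow> pair_wf_digraph (path h)"
  by unfold_locales (auto simp: path_def chain_graphs_def)

lemma component_path:
  assumes "h \<le> m" "a \<le> m"
  shows "component (path h) (chain_graph a) = (if a \<le> h then chain_graph ` {..h} else {chain_graph a})"
proof -
  interpret pair_wf_digraph "path h" using wf_path assms by blast
  have V: "chain_graph a \<in> pverts (path h)" using assms by (simp add: path_def chain_graphs_def)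
  have inside: "K \<in> (if a \<le> h then chain_graph ` {..h} else {chain_graph a})"
    if "(chain_graph a, K) \<in> (parcs (path h))\<^sup>*" for K
    using that
  proof (induction rule: rtrancl_induct)
    case (step K L)
    then show ?case
      using assms chain_graph_eq_iff by (auto simp: path_def split: if_splits)
  qed auto
  have down: "(chain_graph 0, chain_graph b) \<in> (parcs (path h))\<^sup>*" if "b \<le> h" for b
    using that
  proof (induction b)
    case (Suc b)
    then have "(chain_graph b, chain_graph (Suc b)) \<in> parcs (path h)" by (auto intro: path_arcI)
    then show ?case using Suc by (auto intro: rtrancl_into_rtrancl)
  qed simp
  have up: "(chain_graph b, chain_graph 0) \<in> (parcs (path h))\<^sup>*" if "b \<le> h" for b
    using that
  proof (induction b)
    case (Suc b)
    then have "(chain_graph (Suc b), chain_graph b) \<in> parcs (path h)" by (auto intro: path_arcI)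
    then show ?case using Suc by (auto intro: converse_rtrancl_into_rtrancl)
  qed simp
  have all: "(chain_graph b, chain_graph c) \<in> (parcs (path h))\<^sup>*" if "b \<le> h" "c \<le> h" for b c
    using up[OF that(1)] down[OF that(2)] by (rule rtrancl_trans)
  have pv: "chain_graph b \<in> pverts (path h)" if "b \<le> h" for b
    using that assms by (auto simp: path_def chain_graphs_def)
  show ?thesis
    unfolding scc_of_def reachable_with_proj_iff[OF pair_wf_digraph_axioms]
    using inside all V pv by (auto split: if_splits)
qed

lemma indist_graph_chain: "indist_graph P chain_graphs = path m"
proof -
  have adj: "(b = Suc a \<or> a = Suc b) \<longleftrightarrow>
      chain_graph a \<noteq> chain_graph b \<and> label P (chain_graph a) (chain_graph b) \<noteq> {}"
    if "a \<le> m" "b \<le> m" for a b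
    using that R_nonempty label_chain_graph[of a b] label_chain_graph[of b a] chain_graph_eq_iff[OF that]
      label_commute[of "chain_graph a" "chain_graph b"]
    by (cases a b rule: linorder_cases) auto
  have "(G, H) \<in> parcs (indist_graph P chain_graphs) \<longleftrightarrow> (G, H) \<in> parcs (path m)" for G H
  proof
    assume "(G, H) \<in> parcs (indist_graph P chain_graphs)"
    then obtain a b where "a \<le> m" "b \<le> m" "G = chain_graph a" "H = chain_graph b" "G \<noteq> H" "label P G H \<noteq> {}"
      by (auto simp: indist_graph_def chain_graphs_def)
    then show "(G, H) \<in> parcs (path m)" using adj unfolding path_def by auto
  next
    assume "(G, H) \<in> parcs (path m)"
    then obtain a b where "a \<le> m" "b \<le> m" "G = chain_graph a" "H = chain_graph b" "b = Suc a \<or> a = Suc b"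
      unfolding path_def by auto
    then show "(G, H) \<in> parcs (indist_graph P chain_graphs)"
      using adj unfolding indist_graph_def chain_graphs_def by auto
  qed
  then have "parcs (indist_graph P chain_graphs) = parcs (path m)" by auto
  then show ?thesis by (simp add: indist_graph_def path_def)
qed

text \<open>The edge between graphs \<open>a\<close> and \<open>a + 1\<close> has label
  \<open>R (a + 2)\<close>, which by \<open>R_cover\<close> contains the root of graph
  \<open>a + 2\<close> only. That graph is on the path unless \<open>a = h\<close>, so just the last
  edge disappears.\<close>

lemma refine_path:
  assumes "Suc h \<le> m"
  shows "refine P (path (Suc h)) = path h"
proof -
  have supported: "(\<exists>K \<in> component (path (Suc h)) (chain_graph c).
        Root K \<subseteq> label P (chain_graph a) (chain_graph (Suc a))) \<longleftrightarrow> a < h"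
    if "Suc a \<le> Suc h" "c \<le> Suc h" for a c
  proof -
    have lab: "label P (chain_graph a) (chain_graph (Suc a)) = R (Suc (Suc a))"
      using label_chain_graph[of a "Suc a"] that assms by simp
    have comp: "component (path (Suc h)) (chain_graph c) = chain_graph ` {..Suc h}"
      using component_path[of "Suc h" c] assms that by simp
    show ?thesis
    proof
      assume "\<exists>K \<in> component (path (Suc h)) (chain_graph c).
        Root K \<subseteq> label P (chain_graph a) (chain_graph (Suc a))"
      then obtain l where l: "l \<le> Suc h" "R l \<subseteq> R (Suc (Suc a))"
        unfolding lab comp by (auto simp: Root_chain_graph)
      \<comment> \<open>The element and the second set only bring the inclusion into the form of
        \<open>R_cover\<close>. For \<open>a = h\<close> its conclusion contradicts
        \<open>l \<le> Suc h\<close>.\<close>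
      then have "R l \<subseteq> insert undefined (R (Suc (Suc a)) \<union> R (Suc (Suc (Suc a))))" by auto
      then have "a \<noteq> h"
        using R_cover[of l "Suc (Suc a)" undefined] l(1) assms by auto
      then show "a < h" using that by simp
    next
      assume "a < h"
      then show "\<exists>K \<in> component (path (Suc h)) (chain_graph c).
        Root K \<subseteq> label P (chain_graph a) (chain_graph (Suc a))"
        unfolding lab comp by (intro bexI[of _ "chain_graph (Suc (Suc a))"]) (auto simp: Root_chain_graph)
    qed
  qed
  have "(G, H) \<in> parcs (refine P (path (Suc h))) \<longleftrightarrow> (G, H) \<in> parcs (path h)" for G H
  proof
    assume "(G, H) \<in> parcs (refine P (path (Suc h)))"
    then have arc: "(G, H) \<in> parcs (path (Suc h))"
      and sup: "\<exists>K \<in> component (path (Suc h)) G. Root K \<subseteq> label P G H"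
      by (auto simp: refine_def)
    obtain a b where ab: "G = chain_graph a" "H = chain_graph b" "a \<le> Suc h" "b \<le> Suc h"
        "b = Suc a \<or> a = Suc b"
      using arc by (auto simp: path_def)
    show "(G, H) \<in> parcs (path h)"
      using ab(5)
    proof
      assume "b = Suc a"
      then show ?thesis using supported[of a a] sup ab by (auto intro: path_arcI)
    next
      assume "a = Suc b"
      then show ?thesis using supported[of b a] sup ab label_commute[of G H] by (auto intro: path_arcI)
    qed
  next
    assume "(G, H) \<in> parcs (path h)"
    then obtain a b where ab: "G = chain_graph a" "H = chain_graph b" "a \<le> h" "b \<le> h"
        "b = Suc a \<or> a = Suc b"
      by (auto simp: path_def)
    then have arc: "(G, H) \<in> parcs (path (Suc h))" by (auto intro: path_arcI)
    have "\<exists>K \<in> component (path (Suc h)) G. Root K \<subseteq> label P G H"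
      using ab(5)
    proof
      assume "b = Suc a"
      then show ?thesis using supported[of a a] ab by auto
    next
      assume "a = Suc b"
      then show ?thesis using supported[of b a] ab label_commute[of G H] by auto
    qed
    then show "(G, H) \<in> parcs (refine P (path (Suc h)))" using arc by (auto simp: refine_def)
  qed
  then have "parcs (refine P (path (Suc h))) = parcs (path h)" by auto
  then show ?thesis by (simp add: refine_def path_def)
qed

section \<open>Running time and solvability for the chain\<close>

lemma refinement_chain: "i \<le> m \<Longrightarrow> refinement P chain_graphs (Suc i) = path (m - i)"
proof (induction i)
  case 0
  then show ?case by (simp add: refinement_def indist_graph_chain)
next
  case (Suc i)
  then show ?case using refine_path[of "m - Suc i"]
    by (simp add: refinement_Suc[of "Suc i"] Suc_diff_Suc)
qed

text \<open>Both stopping criteria fail: the last iteration removed an edge, and graphs 0 and 1,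
  whose roots are disjoint, are still in one component.\<close>

lemma not_stops_at_chain:
  assumes "2 \<le> i" "i \<le> m"
  shows "\<not> stops_at P chain_graphs i"
proof -
  define h where "h = m - i"
  have h: "Suc (Suc h) \<le> m" "refinement P chain_graphs i = path (Suc h)"
    "refinement P chain_graphs (i - 1) = path (Suc (Suc h))"
    using refinement_chain[of "i - 1"] refinement_chain[of "i - 2"] assms
    by (auto simp: h_def Suc_diff_Suc numeral_2_eq_2 Suc_diff_le)
  have "(chain_graph (Suc h), chain_graph (Suc (Suc h))) \<in> parcs (path (Suc (Suc h)))"
    by (auto intro: path_arcI)
  moreover have "(chain_graph (Suc h), chain_graph (Suc (Suc h))) \<notin> parcs (path (Suc h))"
    using h(1) chain_graph_eq_iff by (auto simp: path_def)
  ultimately have ne: "path (Suc h) \<noteq> path (Suc (Suc h))" by metis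
  interpret pair_wf_digraph "path (Suc h)" using wf_path h(1) by simp
  let ?C = "component (path (Suc h)) (chain_graph 0)"
  have C: "?C = chain_graph ` {..Suc h}" using component_path[of "Suc h" 0] h(1) by simp
  have "chain_graph 0 \<in> ?C" "chain_graph 1 \<in> ?C" unfolding C by auto
  then have "\<not> root_compatible ?C"
    using Root_chain_graph R_disjoint(1)[of 0] unfolding root_compatible_def by fastforce
  moreover have "?C \<in> sccs_verts"
    using scc_of_in_sccs_verts[of "chain_graph 0"] by (simp add: path_def chain_graphs_def)
  ultimately show ?thesis using ne unfolding stops_at_def h(2,3) by auto
qed

lemma TD_chain: "Suc m \<le> TD P chain_graphs"
proof -
  have "stops_at P chain_graphs (TD P chain_graphs)"
    by (rule procedure_stops[OF finite_P adv])
  then have "\<not> TD P chain_graphs \<le> m"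
    using not_stops_at_chain[of "TD P chain_graphs"] by (auto simp: stops_at_def)
  then show ?thesis by simp
qed

text \<open>After \<open>m\<close> refinements no edge is left, so every component is a single
  rooted graph.\<close>

lemma consensus_solvable_chain: "consensus_solvable P V chain_graphs"
proof (rule consensus_solvable_if_root_compatible)
  show "P \<noteq> {}" using R_subset R_nonempty by blast
  interpret N: pair_wf_digraph "path 0" by (rule wf_path) simp
  fix C assume "C \<in> pre_digraph.sccs_verts (with_proj (refinement P chain_graphs (Suc m)))"
  then have "C \<in> N.sccs_verts" by (simp add: refinement_chain)
  then obtain a where "a \<le> m" "C = component (path 0) (chain_graph a)"
    unfolding N.sccs_verts_conv_scc_of by (auto simp: path_def chain_graphs_def)
  then have "C = {chain_graph a}" using component_path[of 0 a] by auto
  then show "root_compatible C"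
    using R_nonempty by (simp add: root_compatible_def rooted_chain_graph Root_chain_graph)
qed

end

section \<open>An exponentially long chain\<close>

text \<open>
  Write a process as \<open>p = 12 s + 6 h + 3 b + c + 1\<close> with \<open>h, b < 2\<close> and \<open>c < 3\<close>. It belongs
  to the \<open>i\<close>-th root iff \<open>c = i mod 3\<close> and \<open>b\<close> is the bit \<open>s\<close> of \<open>i div 3\<close>. The colour \<open>c\<close>
  separates the roots at distance 1 and 2, and \<open>h\<close> provides a twin for every element, which
  is why one additional element \<open>q\<close> does not help to cover a root.
\<close>
definition code_root :: "nat \<Rightarrow> nat \<Rightarrow> nat set" where
  "code_root k i = {p. 1 \<le> p \<and> p \<le> 12 * k \<and> (p - 1) mod 3 = i mod 3 \<and>
     (odd ((p - 1) div 3) \<longleftrightarrow> bit (i div 3) ((p - 1) div 12))}"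

text \<open>For position \<open>s\<close> the twins \<open>el 0\<close> and \<open>el 1\<close> both
  belong to the root, and \<open>q\<close> can equal at most one of them.\<close>

lemma ex_code_root_avoiding:
  assumes "s < k"
  shows "\<exists>p\<in>code_root k i. p \<noteq> q \<and> (p - 1) div 12 = s"
proof -
  define b :: nat where "b = of_bool (bit (i div 3) s)"
  define el where "el h = 12 * s + 6 * h + 3 * b + i mod 3 + 1" for h
  have b: "b < 2" "odd b \<longleftrightarrow> bit (i div 3) s" by (auto simp: b_def)
  have "el h \<in> code_root k i \<and> (el h - 1) div 12 = s" if "h < 2" for h
  proof -
    have c: "i mod 3 < 3" by simp
    have e: "el h - 1 = 3 * (4 * s + 2 * h + b) + i mod 3" by (simp add: el_def)
    have "(el h - 1) mod 3 = i mod 3" unfolding e by (simp only: mod_mult_self4 mod_mod_trivial)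
    moreover have "(el h - 1) div 3 = 4 * s + 2 * h + b" unfolding e using c by simp
    moreover have "(el h - 1) div 12 = s"
      using c b(1) that unfolding el_def by (intro div_nat_eqI) auto
    moreover have "1 \<le> el h" by (simp add: el_def)
    moreover have "el h \<le> 12 * s + 12" using c b(1) that by (simp add: el_def)
    ultimately show ?thesis using b(2) assms by (simp add: code_root_def)
  qed
  moreover have "el 0 \<noteq> el 1" by (simp add: el_def)
  ultimately show ?thesis by (metis one_less_numeral_iff semiring_norm(76) zero_less_numeral)
qed

lemma nat_eq_if_low_bits_eq:
  fixes v w :: nat
  assumes "v < 2 ^ k" "w < 2 ^ k" "\<And>s. s < k \<Longrightarrow> bit v s \<longleftrightarrow> bit w s"
  shows "v = w"
proof -
  have "take_bit k v = take_bit k w"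
    by (rule bit_eqI) (use assms(3) in \<open>auto simp: bit_take_bit_iff\<close>)
  then show ?thesis using assms(1,2) by (simp add: take_bit_nat_eq_self)
qed

text \<open>The colours of \<open>j\<close> and \<open>Suc j\<close> differ, so only one index
  \<open>l\<close> of the two has the colour of \<open>i\<close>. Elements at every position must
  then be covered by the root of \<open>l\<close>, which forces all bits of \<open>i div 3\<close>
  and \<open>l div 3\<close> to agree.\<close>

lemma code_root_cover:
  assumes k: "0 < k" and i: "i < 3 * 2 ^ k" and j: "Suc j < 3 * 2 ^ k"
    and sub: "code_root k i \<subseteq> insert q (code_root k j \<union> code_root k (Suc j))"
  shows "i = j \<or> i = Suc j"
proof -
  have *: "\<exists>l\<in>{j, Suc j}. l mod 3 = i mod 3 \<and> (bit (l div 3) s \<longleftrightarrow> bit (i div 3) s)" if s: "s < k" for s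
  proof -
    obtain p where p: "p \<in> code_root k i" "p \<noteq> q" "(p - 1) div 12 = s"
      using ex_code_root_avoiding[OF s] by blast
    then have "p \<in> code_root k j \<or> p \<in> code_root k (Suc j)" using sub by auto
    then show ?thesis using p by (auto simp: code_root_def)
  qed
  obtain l where l: "l \<in> {j, Suc j}" "l mod 3 = i mod 3" using *[OF k] by blast
  have "bit (i div 3) s \<longleftrightarrow> bit (l div 3) s" if s: "s < k" for s
  proof -
    obtain l' where l': "l' \<in> {j, Suc j}" "l' mod 3 = i mod 3" "bit (l' div 3) s \<longleftrightarrow> bit (i div 3) s"
      using *[OF s] by blast
    have "j mod 3 \<noteq> Suc j mod 3" by presburger
    then have "l' = l" using l l' by auto
    then show ?thesis using l' by simp
  qed
  moreover have "l < 3 * 2 ^ k" using l j by auto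
  then have "l div 3 < 2 ^ k" "i div 3 < 2 ^ k" using i by (simp_all add: less_mult_imp_div_less mult.commute)
  ultimately have "i div 3 = l div 3" using nat_eq_if_low_bits_eq[of "i div 3" k "l div 3"] by blast
  then have "i = l" using l(2) by (metis div_mult_mod_eq)
  then show ?thesis using l by auto
qed

text \<open>The covering condition involves indices up to \<open>m + 2\<close>. With
  \<open>m = 3 * 2 ^ k - 3\<close> these stay below \<open>3 * 2 ^ k\<close>, where \<open>k\<close>
  bits still determine \<open>i div 3\<close>.\<close>

lemma root_chain_code_root:
  assumes "0 < k" "12 * k \<le> n"
  shows "root_chain {1..n} (code_root k) (3 * 2 ^ k - 3)"
proof
  fix i
  show "code_root k i \<subseteq> {1..n}" using assms by (auto simp: code_root_def)
  show "code_root k i \<noteq> {}" using ex_code_root_avoiding[OF assms(1)] by blast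
  have "i mod 3 \<noteq> Suc i mod 3" "i mod 3 \<noteq> Suc (Suc i) mod 3" by presburger+
  then show "code_root k i \<inter> code_root k (Suc i) = {}" "code_root k i \<inter> code_root k (Suc (Suc i)) = {}"
    by (auto simp: code_root_def)
next
  fix i j q
  assume *: "i \<le> 3 * 2 ^ k - 3" "j \<le> Suc (3 * 2 ^ k - 3)"
    "code_root k i \<subseteq> insert q (code_root k j \<union> code_root k (Suc j))"
  have "1 \<le> (2::nat) ^ k" by simp
  then show "i = j \<or> i = Suc j" using code_root_cover[OF assms(1) _ _ *(3)] *(1,2) by linarith
qed simp

theorem theorem3:
  shows "\<exists>(a::real) n0::nat. a > 1 \<and>
    (\<forall>n\<ge>n0. \<exists>D :: nat cgraph set.
       message_adversary {1..n} D \<and>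
       (\<forall>G\<in>D. rooted G) \<and>
       (\<forall>V :: 'v set. finite V \<longrightarrow> consensus_solvable {1..n} V D) \<and>
       real (TD {1..n} D) \<ge> a ^ n)"
proof (intro exI[of _ "2 powr (1 / 24) :: real"] exI[of _ 12] conjI allI impI)
  show "(1::real) < 2 powr (1 / 24)" by simp
  fix n :: nat assume n: "12 \<le> n"
  define k where "k = n div 12"
  \<comment> \<open>The last bound yields the base: \<open>TD\<close> is at least
    \<open>3 * 2 ^ k - 2\<close>, hence at least \<open>2 ^ k\<close>, and \<open>k\<close> is at
    least \<open>n / 24\<close>.\<close>
  have k: "0 < k" "12 * k \<le> n" "n \<le> 24 * k" using n unfolding k_def by presburger+
  interpret root_chain "{1..n}" "code_root k" "3 * 2 ^ k - 3"
    using root_chain_code_root k by blast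
  have "(2 powr (1 / 24)) ^ n = 2 powr (real n / 24)" by (simp add: powr_realpow[symmetric] powr_powr)
  also have "\<dots> \<le> 2 powr real k" using k(3) by (intro powr_mono) auto
  also have "\<dots> = real (2 ^ k)" by (simp add: powr_realpow)
  also have "\<dots> \<le> real (TD {1..n} chain_graphs)"
  proof -
    have "1 \<le> (2::nat) ^ k" by simp
    then have "2 ^ k \<le> TD {1..n} chain_graphs" using TD_chain by linarith
    then show ?thesis by (rule of_nat_mono)
  qed
  finally have "(2 powr (1 / 24)) ^ n \<le> real (TD {1..n} chain_graphs)" .
  then show "\<exists>D :: nat cgraph set.
       message_adversary {1..n} D \<and>
       (\<forall>G\<in>D. rooted G) \<and>
       (\<forall>V :: 'v set. finite V \<longrightarrow> consensus_solvable {1..n} V D) \<and>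
       real (TD {1..n} D) \<ge> (2 powr (1 / 24)) ^ n"
    using adv rooted_chain_graphs consensus_solvable_chain by blast
qed

end
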